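(* Let $(M,d)$ be an ultrametric space and let $A,B\subseteq M$ be nonempty spherically complete subsets such that $B$ is bounded and $\delta(B)\le\mathrm{dist}(A,B)$. Let $T:A\cup B\to A\cup B$ be a noncyclic nonexpansive mapping. Then there exists a pair $(a^*,b^* )\in A\times B$ with $d(a^*,b^* )=\mathrm{dist}(A,B)$ that satisfies at least one of the following statements: (i) $a^*$ and $b^*$ are fixed points of $T$. (ii) $a^*$ is a fixed point of $T$, and the ball $B_B(b^*,d(b^*,Tb^* ))$ of $B$ is a minimal $T$-invariant ball in $B$, each point of which is a nearest point to $a^*$ in $B$ (that is, each $v$ in this ball satisfies $d(a^*,v)=\inf\{d(a^*,z): z\in B\}$). (iii) The ball $B_A(a^*,d(a^*,Ta^* ))$ of $A$ is a minimal $T$-invariant ball in $A$, and the ball $B_B(b^*,d(b^*,Tb^* ))$ of $B$ is a minimal $T$-invariant ball in $B$.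
   Context: An ultrametric space is a metric space $(M,d)$ with $d(x,y)\le\max\{d(x,z),d(z,y)\}$ for all $x,y,z\in M$. An ultrametric space is spherically complete if each nested sequence of (closed) balls $B_1\supseteq B_2\supseteq\cdots$ has nonempty intersection; a subset of $M$ is spherically complete if it is so as a subspace with the induced metric. For a bounded set $B$, $\delta(B)=\sup\{d(x,y): x,y\in B\}$, and $\mathrm{dist}(A,B)=\inf\{d(a,b): a\in A,\ b\in B\}$. A map $T:A\cup B\to A\cup B$ is noncyclic if $T(A)\subseteq A$ and $T(B)\subseteq B$, and nonexpansive if $d(Tx,Ty)\le d(x,y)$ for all $x,y\in A\cup B$. For $S\in\{A,B\}$, $x\in S$ and $r\ge 0$, write $B_S(x,r)=\{y\in S: d(x,y)\le r\}$ for the closed ball of the subspace $S$. The ball $B_S(x,r)$ is a minimal $T$-invariant ball in $S$ if $T(B_S(x,r))\subseteq B_S(x,r)$ and $d(y,Ty)=r$ for every $y\in B_S(x,r)$. No positivity of $r$ is required in this definition. *)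

theory Defs
  imports "HOL-Analysis.Analysis"
begin

definition sub_cball :: "'a::metric_space set \<Rightarrow> 'a \<Rightarrow> real \<Rightarrow> 'a set" where
  "sub_cball S x r = {y \<in> S. dist x y \<le> r}"

(* Centres range over S only: these are the balls of the subspace S, not traces of
   arbitrary balls of the ambient space. *)
definition spherically_complete :: "'a::metric_space set \<Rightarrow> bool" where
  "spherically_complete S \<longleftrightarrow>
     (\<forall>(c :: nat \<Rightarrow> 'a) (r :: nat \<Rightarrow> real).
        (\<forall>n. c n \<in> S \<and> 0 \<le> r n) \<longrightarrow>
        (\<forall>n. sub_cball S (c (Suc n)) (r (Suc n)) \<subseteq> sub_cball S (c n) (r n)) \<longrightarrow>
        (\<Inter>n. sub_cball S (c n) (r n)) \<noteq> {})"

definition noncyclic :: "'a set \<Rightarrow> 'a set \<Rightarrow> ('a \<Rightarrow> 'a) \<Rightarrow> bool" where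
  "noncyclic A B T \<longleftrightarrow> T ` A \<subseteq> A \<and> T ` B \<subseteq> B"

definition nonexpansive_on :: "'a::metric_space set \<Rightarrow> ('a \<Rightarrow> 'a) \<Rightarrow> bool" where
  "nonexpansive_on S T \<longleftrightarrow> (\<forall>x\<in>S. \<forall>y\<in>S. dist (T x) (T y) \<le> dist x y)"

(* r = 0 is allowed; then the ball is {x} and x is a fixed point. *)
definition minimal_invariant_ball ::
    "'a::metric_space set \<Rightarrow> ('a \<Rightarrow> 'a) \<Rightarrow> 'a \<Rightarrow> real \<Rightarrow> bool" where
  "minimal_invariant_ball S T x r \<longleftrightarrow>
     x \<in> S \<and> 0 \<le> r \<and>
     T ` sub_cball S x r \<subseteq> sub_cball S x r \<and>
     (\<forall>y\<in>sub_cball S x r. dist y (T y) = r)"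

end

theory Submission
  imports Defs
begin

text \<open>
  Every closed ball of radius \<open>d(x, Tx)\<close> is \<open>T\<close>-invariant, and passing to a point of it cannot
  increase the displacement \<open>d(x, Tx)\<close>. Choosing points whose displacement is nearly minimal in
  the preceding ball yields a nested sequence of such balls, and any point of the intersection is
  the centre of a minimal invariant ball.

  Since \<open>\<delta>(B) \<le> dist(A, B)\<close>, the distance from a point \<open>a\<close> to a point of \<open>B\<close> does not depend on
  the latter. Spherical completeness of \<open>A\<close> therefore gives a point \<open>a\<^sub>0\<close> at distance
  \<open>dist(A, B)\<close> from all of \<open>B\<close>, and all points of the ball of \<open>A\<close> around \<open>a\<^sub>0\<close> of radius
  \<open>d(a\<^sub>0, Ta\<^sub>0) \<le> dist(A, B)\<close> share this property. Minimal invariant balls inside this ball and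
  inside \<open>B\<close> provide the third alternative; fixed points are the case of radius zero.
\<close>

lemma sub_cball_subset:
  fixes S :: "'a::metric_space set"
  assumes ultrametric: "\<And>x y z :: 'a. dist x y \<le> max (dist x z) (dist z y)"
    and "dist x y \<le> r" and "s \<le> r"
  shows "sub_cball S y s \<subseteq> sub_cball S x r"
proof
  fix w assume "w \<in> sub_cball S y s"
  then show "w \<in> sub_cball S x r"
    using ultrametric[of x w y] assms(2,3) by (auto simp: sub_cball_def)
qed

text \<open>Going from \<open>y\<close> to \<open>T y\<close> through \<open>x\<close> and
  \<open>T x\<close> takes three steps, each of length at most \<open>dist x (T x)\<close>; the last
  one is bounded by nonexpansiveness.\<close>

lemma displacement_le:
  fixes S :: "'a::metric_space set"
  assumes ultrametric: "\<And>x y z :: 'a. dist x y \<le> max (dist x z) (dist z y)"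
    and "nonexpansive_on S T" and "x \<in> S" and "y \<in> sub_cball S x (dist x (T x))"
  shows "dist y (T y) \<le> dist x (T x)"
proof -
  have y: "y \<in> S" "dist x y \<le> dist x (T x)"
    using assms(4) by (auto simp: sub_cball_def)
  have "dist (T x) (T y) \<le> dist x y"
    using assms(2,3) y(1) by (auto simp: nonexpansive_on_def)
  then show ?thesis
    using y(2) ultrametric[of y "T y" x] ultrametric[of x "T y" "T x"]
    by (simp add: dist_commute max_def split: if_splits)
qed

lemma ex_minimal_invariant_ball:
  fixes S :: "'a::metric_space set"
  assumes ultrametric: "\<And>x y z :: 'a. dist x y \<le> max (dist x z) (dist z y)"
    and "spherically_complete S" and TS: "T ` S \<subseteq> S" and ne: "nonexpansive_on S T"
    and "x \<in> S"
  shows "\<exists>z\<in>sub_cball S x (dist x (T x)). minimal_invariant_ball S T z (dist z (T z))"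
proof -
  let ?r = "\<lambda>y. dist y (T y)"
  let ?B = "\<lambda>y. sub_cball S y (?r y)"
  note r_le = displacement_le[OF ultrametric ne]
  have B_subset: "?B v \<subseteq> ?B u" if "u \<in> S" "v \<in> ?B u" for u v
    using sub_cball_subset[OF ultrametric _ r_le[OF that], of u] that(2)
    by (simp add: sub_cball_def)
  \<comment> \<open>The infimum of the displacement over a ball need not be attained, hence a slack
    that vanishes along the sequence.\<close>
  have ex_near_min: "\<exists>v. v \<in> ?B u \<and> (\<forall>w\<in>?B u. ?r v \<le> ?r w + 1 / real (Suc n))"
    if "u \<in> S" for u n
  proof -
    have ne': "?r ` ?B u \<noteq> {}" and bdd: "bdd_below (?r ` ?B u)"
      using that by (auto simp: sub_cball_def intro!: bdd_belowI[of _ 0])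
    have "Inf (?r ` ?B u) < Inf (?r ` ?B u) + 1 / real (Suc n)"
      by simp
    then obtain v where v: "v \<in> ?B u" "?r v < Inf (?r ` ?B u) + 1 / real (Suc n)"
      using cInf_less_iff[OF ne' bdd] by blast
    have "?r v \<le> ?r w + 1 / real (Suc n)" if "w \<in> ?B u" for w
      using v(2) cInf_lower[OF imageI[OF that] bdd] by linarith
    with v(1) show ?thesis by blast
  qed
  \<comment> \<open>Pinning the start to \<open>x\<close> places the final centre in the ball around
    \<open>x\<close>.\<close>
  have "\<exists>f. \<forall>n. (f n \<in> S \<and> (n = 0 \<longrightarrow> f n = x)) \<and>
      (f (Suc n) \<in> ?B (f n) \<and> (\<forall>w\<in>?B (f n). ?r (f (Suc n)) \<le> ?r w + 1 / real (Suc n)))"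
  proof (rule dependent_nat_choice)
    show "\<exists>y. y \<in> S \<and> (0 = (0::nat) \<longrightarrow> y = x)"
      using \<open>x \<in> S\<close> by blast
  next
    fix u n assume "u \<in> S \<and> (n = (0::nat) \<longrightarrow> u = x)"
    then obtain v where "v \<in> ?B u" "\<forall>w\<in>?B u. ?r v \<le> ?r w + 1 / real (Suc n)"
      using ex_near_min by blast
    then show "\<exists>v. (v \<in> S \<and> (Suc n = 0 \<longrightarrow> v = x)) \<and>
        (v \<in> ?B u \<and> (\<forall>w\<in>?B u. ?r v \<le> ?r w + 1 / real (Suc n)))"
      by (auto simp: sub_cball_def)
  qed
  then obtain f where f: "\<And>n. f n \<in> S" "f 0 = x" "\<And>n. f (Suc n) \<in> ?B (f n)"
    "\<And>n w. w \<in> ?B (f n) \<Longrightarrow> ?r (f (Suc n)) \<le> ?r w + 1 / real (Suc n)"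
    by blast
  have "(\<Inter>n. ?B (f n)) \<noteq> {}"
    using assms(2)[unfolded spherically_complete_def, rule_format, of f "\<lambda>n. ?r (f n)"]
      B_subset[OF f(1,3)] f(1) by simp
  then obtain z where z: "\<And>n. z \<in> ?B (f n)"
    by blast
  then have "z \<in> S"
    by (auto simp: sub_cball_def)
  have const: "?r y = ?r z" if "y \<in> ?B z" for y
  proof (rule antisym)
    show "?r y \<le> ?r z"
      using r_le[OF \<open>z \<in> S\<close> that] .
    \<comment> \<open>Since \<open>y\<close> lies in \<open>?B (f n)\<close>, it competes in the
      choice of \<open>f (Suc n)\<close>, whose displacement in turn bounds that of
      \<open>z\<close>.\<close>
    have "?r z \<le> ?r y + 1 / real (Suc n)" for n
      using r_le[OF f(1) z[of "Suc n"]] f(4)[of y n] B_subset[OF f(1) z[of n]] that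
      by fastforce
    then show "?r z \<le> ?r y"
      by (metis add_diff_cancel_left' diff_gt_0_iff_gt diff_add_cancel add.commute
          linorder_not_le nat_approx_posE less_diff_eq)
  qed
  have "T ` ?B z \<subseteq> ?B z"
  proof (intro image_subsetI)
    fix y assume y: "y \<in> ?B z"
    then have "y \<in> S" "dist z y \<le> ?r z"
      by (auto simp: sub_cball_def)
    then show "T y \<in> ?B z"
      using TS const[OF y] ultrametric[of z "T y" y] by (auto simp: sub_cball_def)
  qed
  with const \<open>z \<in> S\<close> have "minimal_invariant_ball S T z (?r z)"
    by (simp add: minimal_invariant_ball_def)
  then show ?thesis
    using z[of 0] f(2) by blast
qed

text \<open>The detour from \<open>b\<close> to \<open>b'\<close> costs at most
  \<open>diameter B\<close>, hence at most \<open>dist a b\<close>. Exchanging \<open>b\<close> and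
  \<open>b'\<close> gives equality.\<close>

lemma dist_le_of_diameter_le_setdist:
  fixes A B :: "'a::metric_space set"
  assumes ultrametric: "\<And>x y z :: 'a. dist x y \<le> max (dist x z) (dist z y)"
    and "bounded B" and "diameter B \<le> setdist A B"
    and "a \<in> A" and "b \<in> B" and "b' \<in> B"
  shows "dist a b' \<le> dist a b"
  using ultrametric[of a b' b] setdist_le_dist[OF assms(4,5)] assms(3)
    diameter_bounded_bound[OF assms(2,5,6)] by linarith

lemma ex_dist_eq_setdist:
  fixes A B :: "'a::metric_space set"
  assumes ultrametric: "\<And>x y z :: 'a. dist x y \<le> max (dist x z) (dist z y)"
    and "A \<noteq> {}" and "spherically_complete A"
    and "bounded B" and "diameter B \<le> setdist A B" and "b \<in> B"
  shows "\<exists>a\<in>A. dist a b = setdist A B"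
proof -
  let ?D = "setdist A B"
  let ?R = "\<lambda>n. ?D + 1 / real (Suc n)"
  have "\<exists>a\<in>A. dist a b < ?R n" for n
  proof (rule ccontr)
    \<comment> \<open>By the preceding lemma, if no point of \<open>A\<close> came this close to the
      fixed \<open>b\<close>, none would come this close to any point of \<open>B\<close>, against
      the definition of the infimum.\<close>
    assume far: "\<not> ?thesis"
    have "?R n \<le> dist a b'" if "a \<in> A" "b' \<in> B" for a b'
      using far that(1)
        dist_le_of_diameter_le_setdist[OF ultrametric assms(4,5) that \<open>b \<in> B\<close>] by fastforce
    then have "?R n \<le> ?D"
      using \<open>A \<noteq> {}\<close> \<open>b \<in> B\<close> by (intro le_setdistI) auto
    then show False by (simp add: field_simps)
  qed
  then obtain c where c: "\<And>n. c n \<in> A" "\<And>n. dist (c n) b < ?R n"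
    by metis
  have R_mono: "?R (Suc n) \<le> ?R n" for n
    by (simp add: field_simps)
  have "sub_cball A (c (Suc n)) (?R (Suc n)) \<subseteq> sub_cball A (c n) (?R n)" for n
  proof (rule sub_cball_subset[OF ultrametric _ R_mono])
    \<comment> \<open>Both centres are within \<open>?R n\<close> of \<open>b\<close>.\<close>
    show "dist (c n) (c (Suc n)) \<le> ?R n"
      using ultrametric[of "c n" "c (Suc n)" b] c(2)[of n] c(2)[of "Suc n"] R_mono[of n]
      unfolding dist_commute[of b] by linarith
  qed
  then have "(\<Inter>n. sub_cball A (c n) (?R n)) \<noteq> {}"
    using assms(3)[unfolded spherically_complete_def, rule_format, of c ?R] c(1)
      setdist_pos_le[of A B] by simp
  then obtain z where z: "\<And>n. z \<in> sub_cball A (c n) (?R n)"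
    by blast
  then have "z \<in> A"
    by (auto simp: sub_cball_def)
  have "dist z b \<le> ?R n" for n
    using ultrametric[of z b "c n"] c(2)[of n] z[of n]
    by (simp add: sub_cball_def dist_commute max_def split: if_splits)
  then have "dist z b \<le> ?D"
    by (metis add_diff_cancel_left' diff_gt_0_iff_gt diff_add_cancel add.commute
        linorder_not_le nat_approx_posE less_diff_eq)
  then show ?thesis
    using setdist_le_dist[OF \<open>z \<in> A\<close> \<open>b \<in> B\<close>] \<open>z \<in> A\<close> by force
qed

theorem theorem2p3:
  fixes A B :: "'a::metric_space set" and T :: "'a \<Rightarrow> 'a"
  assumes ultrametric: "\<And>x y z :: 'a. dist x y \<le> max (dist x z) (dist z y)"
    and "A \<noteq> {}" and "B \<noteq> {}"
    and "spherically_complete A" and "spherically_complete B"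
    and "bounded B"
    and "diameter B \<le> setdist A B"
    and "T \<in> A \<union> B \<rightarrow> A \<union> B"
    and "noncyclic A B T"
    and "nonexpansive_on (A \<union> B) T"
  shows "\<exists>a\<in>A. \<exists>b\<in>B. dist a b = setdist A B \<and>
     ((T a = a \<and> T b = b) \<or>
      (T a = a \<and> minimal_invariant_ball B T b (dist b (T b)) \<and>
         (\<forall>v\<in>sub_cball B b (dist b (T b)). dist a v = infdist a B)) \<or>
      (minimal_invariant_ball A T a (dist a (T a)) \<and>
       minimal_invariant_ball B T b (dist b (T b))))"
proof -
  have TA: "T ` A \<subseteq> A" and TB: "T ` B \<subseteq> B"
    using assms(9) by (auto simp: noncyclic_def)
  have neA: "nonexpansive_on A T" and neB: "nonexpansive_on B T"
    using assms(10) by (auto simp: nonexpansive_on_def)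
  note dist_le = dist_le_of_diameter_le_setdist[OF ultrametric assms(6,7)]
  obtain b where b: "b \<in> B" "minimal_invariant_ball B T b (dist b (T b))"
    using ex_minimal_invariant_ball[OF ultrametric assms(5) TB neB] \<open>B \<noteq> {}\<close>
    by (auto simp: sub_cball_def)
  obtain a0 where a0: "a0 \<in> A" "dist a0 b = setdist A B"
    using ex_dist_eq_setdist[OF ultrametric assms(2,4,6,7) b(1)] by blast
  obtain a where a: "a \<in> sub_cball A a0 (dist a0 (T a0))"
      "minimal_invariant_ball A T a (dist a (T a))"
    using ex_minimal_invariant_ball[OF ultrametric assms(4) TA neA a0(1)] by blast
  have "a \<in> A" and a_near: "dist a0 a \<le> dist a0 (T a0)"
    using a(1) by (auto simp: sub_cball_def)
  have "T a0 \<in> A" "T b \<in> B"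
    using TA TB a0(1) b(1) by auto
  \<comment> \<open>Nonexpansiveness only controls the distance to \<open>T b\<close>; replacing
    \<open>T b\<close> by \<open>b\<close> costs nothing, so \<open>T a0\<close> is as close to
    \<open>b\<close> as \<open>a0\<close>.\<close>
  then have "dist (T a0) b \<le> dist (T a0) (T b)"
    using dist_le b(1) by blast
  also have "\<dots> \<le> dist a0 b"
    using assms(10) a0(1) b(1) by (auto simp: nonexpansive_on_def)
  finally have "dist a0 (T a0) \<le> setdist A B"
    using ultrametric[of a0 "T a0" b] a0(2) by (simp add: dist_commute)
  then have "dist a b \<le> setdist A B"
    using ultrametric[of a b a0] a_near a0(2) by (simp add: dist_commute)
  then have "dist a b = setdist A B"
    using setdist_le_dist[OF \<open>a \<in> A\<close> b(1)] by linarith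
  then show ?thesis
    using \<open>a \<in> A\<close> b a(2) by blast
qed

end
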